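(* Let $J$ be a bounded interval. For each $p$ with $1<p<\infty$ there exist a weight $\omega$ on $J$ with mean value one on $J$ and $\omega\in\mathbf{RH}_p^d$, and a number $\lambda\in(0,1)$, such that the weight $\omega_\lambda$ obtained from $\omega$ by the $\lambda$-operation is not in $\mathbf{RH}_p^d$.
   Context: Let $J$ be a bounded interval (e.g. $J=[0,1]$). $\mathcal{D}(J)$ denotes the family of dyadic subintervals of $J$, i.e. the intervals obtained from $J$ (including $J$ itself) by repeated bisection. For $I\in\mathcal{D}(J)$, $I_l$ and $I_r$ are its left and right halves, and $\widetilde I$ is the parent of $I$ (for $I\neq J$) if $I=\widetilde I_l$ or $I=\widetilde I_r$. $|I|$ is the length of $I$, and $m_I f=\frac1{|I|}\int_I f$. The Haar function of $I$ is $h_I=|I|^{-1/2}(\chi_{I_r}-\chi_{I_l})$, and $\langle\cdot,\cdot\rangle$ is the $L^2$ pairing $\langle f,g\rangle=\int fg$. A weight on $J$ is a positive (a.e.) locally integrable function on $J$ (integrable on $J$). It is dyadic doubling if there is a constant $C$ with $\int_{\widetilde I}\omega\le C\int_I\omega$ for all $I\in\mathcal{D}(J)$, $I\ne J$. For $1<p<\infty$, $\omega\in\mathbf{RH}_p^d$ (the dyadic doubling reverse Hölder class) if $\omega$ is dyadic doubling and there is a constant $C$ with $\left(\frac1{|I|}\int_I\omega^p\right)^{1/p}\le C\,\frac1{|I|}\int_I\omega$ for all $I\in\mathcal{D}(J)$. The $\lambda$-operation: for a weight $\omega$ with mean value one on $J$ put $b_I=\langle\omega,h_I\rangle/m_I\omega$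 for $I\in\mathcal{D}(J)$, so that $\omega(x)=\prod_{I\in\mathcal{D}(J)}(1+b_Ih_I(x))$; for $-1\le\lambda\le1$ define $$\omega_\lambda(x)=\prod_{I\in\mathcal{D}(J)}\bigl(1+\lambda b_Ih_I(x)\bigr),$$ the infinite product being the almost everywhere limit as $n\to\infty$ of the partial products over those $I\in\mathcal{D}(J)$ with $|I|>2^{-n}|J|$. *)

theory Defs
  imports "HOL-Analysis.Analysis"
begin

text \<open>
  An interval may contain or omit each of its endpoints. Bisection puts the midpoint into the
  right half, so that the two halves partition the interval.
\<close>

definition midpt :: "real set \<Rightarrow> real" where
  "midpt I = (Inf I + Sup I) / 2"

definition left_half :: "real set \<Rightarrow> real set" where
  "left_half I = {x \<in> I. x < midpt I}"

definition right_half :: "real set \<Rightarrow> real set" where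
  "right_half I = {x \<in> I. midpt I \<le> x}"

inductive_set dyadic :: "real set \<Rightarrow> real set set" for J :: "real set" where
  self: "J \<in> dyadic J"
| left: "I \<in> dyadic J \<Longrightarrow> left_half I \<in> dyadic J"
| right: "I \<in> dyadic J \<Longrightarrow> right_half I \<in> dyadic J"

abbreviation len :: "real set \<Rightarrow> real" where
  "len I \<equiv> measure lebesgue I"

definition mean :: "real set \<Rightarrow> (real \<Rightarrow> real) \<Rightarrow> real" where
  "mean I f = (1 / len I) * (LINT x:I|lebesgue. f x)"

definition haar :: "real set \<Rightarrow> real \<Rightarrow> real" where
  "haar I x = len I powr (-1/2) * (indicator (right_half I) x - indicator (left_half I) x)"

definition pairing :: "real set \<Rightarrow> (real \<Rightarrow> real) \<Rightarrow> (real \<Rightarrow> real) \<Rightarrow> real" where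
  "pairing J f g = (LINT x:J|lebesgue. f x * g x)"

definition weight :: "real set \<Rightarrow> (real \<Rightarrow> real) \<Rightarrow> bool" where
  "weight J w \<longleftrightarrow> set_integrable lebesgue J w \<and> (AE x in lebesgue. x \<in> J \<longrightarrow> 0 < w x)"

text \<open>The interval \<open>K\<close> below is the parent of \<open>I\<close>.\<close>

definition dyadic_doubling :: "real set \<Rightarrow> (real \<Rightarrow> real) \<Rightarrow> bool" where
  "dyadic_doubling J w \<longleftrightarrow>
     (\<exists>C. \<forall>K\<in>dyadic J. \<forall>I. I = left_half K \<or> I = right_half K \<longrightarrow>
        (LINT x:K|lebesgue. w x) \<le> C * (LINT x:I|lebesgue. w x))"

text \<open>
  The Bochner integral of a non-integrable function is 0, so the finiteness of the integral of
  \<open>w\<^sup>p\<close>, implicit in the reverse Hoelder inequality, has to be required explicitly.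
\<close>

definition RHd :: "real \<Rightarrow> real set \<Rightarrow> (real \<Rightarrow> real) set" where
  "RHd p J = {w. weight J w \<and> dyadic_doubling J w \<and>
     (\<exists>C. \<forall>I\<in>dyadic J. set_integrable lebesgue I (\<lambda>x. w x powr p) \<and>
        mean I (\<lambda>x. w x powr p) powr (1 / p) \<le> C * mean I w)}"

definition haar_ratio :: "real set \<Rightarrow> (real \<Rightarrow> real) \<Rightarrow> real set \<Rightarrow> real" where
  "haar_ratio J w I = pairing J w (haar I) / mean I w"

definition lambda_partial :: "real set \<Rightarrow> real \<Rightarrow> (real \<Rightarrow> real) \<Rightarrow> nat \<Rightarrow> real \<Rightarrow> real" where
  "lambda_partial J l w n x =
     (\<Prod>I\<in>{I\<in>dyadic J. len I > 2 powr (- real n) * len J}. 1 + l * haar_ratio J w I * haar I x)"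

text \<open>Meaningful at the points where the partial products converge.\<close>

definition lambda_op :: "real set \<Rightarrow> real \<Rightarrow> (real \<Rightarrow> real) \<Rightarrow> real \<Rightarrow> real" where
  "lambda_op J l w x = lim (\<lambda>n. lambda_partial J l w n x)"

end

theory Submission
  imports Defs
begin

text \<open>
  The example is a weight that oscillates boundedly along a single nested sequence of dyadic
  intervals. Let \<open>J\<^sub>n\<close> be the leftmost dyadic interval of generation \<open>n\<close>. A weight that is constant on
  each shell \<open>J\<^sub>n - J\<^sub>n\<^sub>+\<^sub>1\<close> is determined by numbers \<open>e\<^sub>n \<in> (-1, 1)\<close>: passing from \<open>J\<^sub>n\<close> to
  \<open>J\<^sub>n\<^sub>+\<^sub>1\<close> multiplies its mean by \<open>1 + e\<^sub>n\<close>, so its mean over \<open>J\<^sub>n\<close> is \<open>\<Prod>k<n. 1 + e\<^sub>k\<close> and its value on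
  the shell is \<open>1 - e\<^sub>n\<close> times that mean. Its Haar ratios vanish off the \<open>J\<^sub>n\<close>, and the
  \<open>\<lambda>\<close>-operation replaces \<open>e\<^sub>n\<close> by \<open>\<lambda> e\<^sub>n\<close> (\<open>haar_ratio_nest\<close>, \<open>haar_ratio_shell\<close>,
  \<open>lambda_partial_tendsto\<close>).

  Take \<open>e\<close> periodic: \<open>K\<close> times the value \<open>s \<in> (0, 1)\<close>, then once the value \<open>-d\<close> that
  exactly compensates, \<open>(1 + s)\<^sup>K (1 - d) = 1\<close>. The means over the \<open>J\<^sub>n\<close> then stay between 1 and
  \<open>(1 + s)\<^sup>K\<close>, so the weight lies between two positive constants and satisfies every reverse
  Hoelder inequality (\<open>RHd_bounded\<close>). With \<open>\<lambda> = s\<close> the compensation fails: although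
  the last factor \<open>1 - d\<close> cancelled the growth of the whole period, the factor
  \<open>1 - s d\<close> exceeds \<open>1 - s\<close> however large \<open>K\<close> is. The mean of the new weight over \<open>J\<^sub>n\<close> is
  therefore multiplied in each period by at least \<open>(1 + s\<^sup>2)\<^sup>K (1 - s)\<close>. Because \<open>2 powr (1/p) < 2\<close>, some \<open>s < 1\<close> has
  \<open>1 + s\<^sup>2 > 2 powr (1/p)\<close>, and for large \<open>K\<close> the \<open>p\<close>-th power of that factor beats the factor
  \<open>2\<^sup>-\<^sup>(\<^sup>K\<^sup>+\<^sup>1\<^sup>)\<close> by which the length of \<open>J\<^sub>n\<close> shrinks (\<open>parameters_exist\<close>). So the integrals of
  the \<open>p\<close>-th power of the new weight over the shells are unbounded (\<open>shell_weight_not_RHd\<close>),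
  although the new weight itself is integrable (\<open>shell_weight_integrable\<close>).
\<close>

section \<open>Bounded intervals and their halves\<close>

text \<open>
  A bounded interval given by its endpoints, which may or may not belong to it. In this form the
  property passes to the two halves without case distinctions.
\<close>

definition endpoints :: "real set \<Rightarrow> real \<Rightarrow> real \<Rightarrow> bool" where
  "endpoints I lo hi \<longleftrightarrow> lo < hi \<and> {lo<..<hi} \<subseteq> I \<and> I \<subseteq> {lo..hi}"

lemma endpoints_Inf_Sup:
  assumes "endpoints I lo hi"
  shows "Inf I = lo" "Sup I = hi" "midpt I = (lo + hi) / 2"
proof -
  have lt: "lo < hi" and sub: "{lo<..<hi} \<subseteq> I" "I \<subseteq> {lo..hi}"
    using assms by (auto simp: endpoints_def)
  have bdd: "bdd_below I" "bdd_above I"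
    using sub(2) by (auto intro: bdd_below_mono bdd_above_mono)
  have ne: "I \<noteq> {}" "{lo<..<hi} \<noteq> {}"
    using sub lt by auto
  have "Inf I \<le> lo"
    using cInf_superset_mono[OF ne(2) bdd(1) sub(1)] lt by simp
  moreover have "lo \<le> Inf I"
    using ne(1) sub(2) by (intro cInf_greatest) auto
  ultimately show "Inf I = lo" by simp
  moreover have "hi \<le> Sup I"
    using cSup_subset_mono[OF ne(2) bdd(2) sub(1)] lt by simp
  moreover have "Sup I \<le> hi"
    using ne(1) sub(2) by (intro cSup_least) auto
  ultimately show "Sup I = hi" "midpt I = (lo + hi) / 2"
    by (simp_all add: midpt_def)
qed

lemma endpoints_halves:
  assumes "endpoints I lo hi"
  shows "endpoints (left_half I) lo ((lo + hi) / 2)" "endpoints (right_half I) ((lo + hi) / 2) hi"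
  using assms endpoints_Inf_Sup(3)[OF assms]
  by (auto simp: endpoints_def left_half_def right_half_def)

lemma endpoints_measure:
  assumes "endpoints I lo hi"
  shows "I \<in> sets lebesgue" "emeasure lebesgue I = ennreal (hi - lo)" "len I = hi - lo"
proof -
  have lt: "lo < hi" and sub: "{lo<..<hi} \<subseteq> I" "I \<subseteq> {lo..hi}"
    using assms by (auto simp: endpoints_def)
  have "I = {lo<..<hi} \<union> (I \<inter> {lo, hi})"
    using sub by (auto simp: order.order_iff_strict)
  moreover have "finite (I \<inter> {lo, hi})" by simp
  ultimately have "I \<in> sets borel"
    by (metis borel_open finite_imp_closed borel_closed open_greaterThanLessThan sets.Un)
  then show meas: "I \<in> sets lebesgue" by simp
  have "emeasure lebesgue {lo<..<hi} \<le> emeasure lebesgue I"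
    using sub(1) meas by (rule emeasure_mono)
  moreover have "emeasure lebesgue I \<le> emeasure lebesgue {lo..hi}"
    using sub(2) by (rule emeasure_mono) simp
  ultimately show em: "emeasure lebesgue I = ennreal (hi - lo)"
    using lt by simp
  show "len I = hi - lo"
    using lt by (simp add: measure_def em)
qed

lemma endpoints_exist:
  fixes J :: "real set"
  assumes "is_interval J" "bounded J" "interior J \<noteq> {}"
  obtains a b where "endpoints J a b"
proof
  obtain x e where "e > 0" and ball: "ball x e \<subseteq> J"
    using assms(3) by (auto simp: mem_interior)
  then have mem: "x \<in> J" "x + e / 2 \<in> J"
    by (auto simp: dist_real_def intro!: subsetD[OF ball])
  have bdd: "bdd_below J" "bdd_above J"
    using assms(2) by (simp_all add: bounded_imp_bdd_below bounded_imp_bdd_above)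
  have "Inf J < Sup J"
    using cInf_lower[OF mem(1) bdd(1)] cSup_upper[OF mem(2) bdd(2)] \<open>e > 0\<close> by simp
  moreover have "y \<in> J" if y: "Inf J < y" "y < Sup J" for y
  proof -
    obtain u v where "u \<in> J" "u < y" "v \<in> J" "y < v"
      using cInf_lessD[of J y] less_cSupD[of J y] y mem(1) by blast
    then show ?thesis
      using assms(1) by (meson less_imp_le mem_is_interval_1_I)
  qed
  ultimately show "endpoints J (Inf J) (Sup J)"
    using bdd by (auto simp: endpoints_def cInf_lower cSup_upper)
qed

lemma dyadic_endpoints:
  assumes "endpoints J a b" "I \<in> dyadic J"
  obtains lo hi where "endpoints I lo hi"
proof -
  have "\<exists>lo hi. endpoints I lo hi"
    using assms(2) by induction (use assms(1) endpoints_halves in blast)+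
  then show ?thesis using that by blast
qed

lemma dyadic_subset: "I \<in> dyadic J \<Longrightarrow> I \<subseteq> J"
  by (induction rule: dyadic.induct) (auto simp: left_half_def right_half_def)

text \<open>
  In \<open>lambda_partial\<close> the \<open>n\<close>-th partial product runs over the intervals longer than \<open>2\<^sup>-\<^sup>n\<close> times
  the whole; these are the ones of generation below \<open>n\<close>.
\<close>

lemma generation_less_iff:
  assumes "0 < c"
  shows "2 powr (- real n) * c < c / 2 ^ k \<longleftrightarrow> k < n"
proof -
  have "2 powr (- real n) * c = c / 2 ^ n"
    by (simp add: powr_minus powr_realpow divide_inverse mult.commute)
  moreover have "c / 2 ^ n < c / 2 ^ k \<longleftrightarrow> (2::real) ^ k < 2 ^ n"
    using assms by (simp add: divide_less_cancel pos_divide_less_eq mult_less_cancel_left_pos less_divide_eq)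
  ultimately show ?thesis by simp
qed

text \<open>
  A product over an infinite index set is 1 by convention, so the partial products of the
  \<open>\<lambda>\<close>-operation say something only because there are finitely many intervals of each generation.
\<close>

lemma finite_long_dyadic:
  assumes J: "endpoints J a b"
  shows "finite {I \<in> dyadic J. len I > 2 powr (- real n) * len J}"
proof -
  define gen where "gen = rec_nat {J} (\<lambda>_ G. left_half ` G \<union> right_half ` G)"
  have gen_0: "gen 0 = {J}"
    and gen_Suc: "gen (Suc k) = left_half ` gen k \<union> right_half ` gen k" for k
    by (simp_all add: gen_def)
  have fin: "finite (gen k)" for k
    by (induction k) (simp_all add: gen_0 gen_Suc)
  have ends: "\<exists>lo. endpoints I lo (lo + (b - a) / 2 ^ k)" if "I \<in> gen k" for I k
    using that
  proof (induction k arbitrary: I)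
    case 0
    then show ?case using J by (auto simp: gen_0 intro!: exI[of _ a])
  next
    case (Suc k)
    then obtain K where "K \<in> gen k" and I: "I = left_half K \<or> I = right_half K"
      by (auto simp: gen_Suc)
    with Suc.IH obtain lo where "endpoints K lo (lo + (b - a) / 2 ^ k)" by blast
    note endpoints_halves[OF this]
    moreover have "(lo + (lo + (b - a) / 2 ^ k)) / 2 = lo + (b - a) / 2 ^ Suc k"
      "lo + (b - a) / 2 ^ k = (lo + (b - a) / 2 ^ Suc k) + (b - a) / 2 ^ Suc k"
      by (simp_all add: field_simps)
    ultimately show ?case using I by metis
  qed
  have ex: "\<exists>k. I \<in> gen k" if "I \<in> dyadic J" for I
    using that
  proof induction
    case self
    then show ?case using gen_0 by blast
  next
    case (left I)
    then show ?case using gen_Suc by blast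
  next
    case (right I)
    then show ?case using gen_Suc by blast
  qed
  have "{I \<in> dyadic J. len I > 2 powr (- real n) * len J} \<subseteq> (\<Union>k<n. gen k)"
  proof
    fix I assume "I \<in> {I \<in> dyadic J. len I > 2 powr (- real n) * len J}"
    then have I: "I \<in> dyadic J" "len I > 2 powr (- real n) * (b - a)"
      using endpoints_measure(3)[OF J] by auto
    then obtain k where k: "I \<in> gen k" using ex by blast
    then have "len I = (b - a) / 2 ^ k"
      using ends endpoints_measure(3) by fastforce
    then have "k < n"
      using I(2) J generation_less_iff[of "b - a" n k] by (simp add: endpoints_def)
    with k show "I \<in> (\<Union>k<n. gen k)" by blast
  qed
  then show ?thesis
    by (rule finite_subset) (use fin in blast)
qed

section \<open>Weights between two positive constants\<close>

lemma set_integral_constant: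
  fixes c :: real
  assumes "endpoints I lo hi" "\<And>x. x \<in> I \<Longrightarrow> f x = c"
  shows "(LINT x:I|lebesgue. f x) = c * (hi - lo)"
proof -
  have "(LINT x:I|lebesgue. f x) = (LINT x:I|lebesgue. c)"
    using assms(2) endpoints_measure(1)[OF assms(1)] by (intro set_lebesgue_integral_cong) auto
  also have "\<dots> = c * (hi - lo)"
    using endpoints_measure[OF assms(1)] by (simp add: set_lebesgue_integral_def)
  finally show ?thesis .
qed

lemma set_integrable_bounded:
  fixes f :: "real \<Rightarrow> real"
  assumes "endpoints I lo hi" "f \<in> borel_measurable lebesgue" "\<And>x. \<bar>f x\<bar> \<le> B"
  shows "set_integrable lebesgue I f"
proof -
  have [measurable]: "I \<in> sets lebesgue" "f \<in> borel_measurable lebesgue"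
    using endpoints_measure(1)[OF assms(1)] assms(2) .
  have "integrable lebesgue (\<lambda>x. indicator I x * B)"
    using endpoints_measure[OF assms(1)] by (intro integrable_mult_left) simp
  then show ?thesis
    unfolding set_integrable_def
    by (rule Bochner_Integration.integrable_bound)
       (use assms(3) in \<open>auto simp: indicator_def intro: order_trans[OF _ abs_ge_self]\<close>)
qed

lemma set_integral_bounds:
  fixes f :: "real \<Rightarrow> real"
  assumes I: "endpoints I lo hi" and f: "f \<in> borel_measurable lebesgue"
    and bounds: "\<And>x. A \<le> f x" "\<And>x. f x \<le> B"
  shows "A * (hi - lo) \<le> (LINT x:I|lebesgue. f x)" "(LINT x:I|lebesgue. f x) \<le> B * (hi - lo)"
proof -
  have int: "set_integrable lebesgue I f"
    by (rule set_integrable_bounded[OF I f, where B="max \<bar>A\<bar> \<bar>B\<bar>"]) (use bounds in \<open>smt (verit)\<close>)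
  have const: "set_integrable lebesgue I (\<lambda>_. c)" for c :: real
    by (rule set_integrable_bounded[OF I, where B="\<bar>c\<bar>"]) auto
  show "A * (hi - lo) \<le> (LINT x:I|lebesgue. f x)"
    using set_integral_mono[OF const[of A] int] bounds(1) set_integral_constant[OF I, of "\<lambda>_. A"]
    by simp
  show "(LINT x:I|lebesgue. f x) \<le> B * (hi - lo)"
    using set_integral_mono[OF int const[of B]] bounds(2) set_integral_constant[OF I, of "\<lambda>_. B"]
    by simp
qed

text \<open>
  If \<open>A \<le> w \<le> B\<close>, the integral of \<open>w\<close> over any interval is its length up to a factor
  in \<open>[A, B]\<close>, and every power mean of \<open>w\<close> is at most \<open>B\<close> while its mean is at least \<open>A\<close>. Hence
  \<open>2 B / A\<close> serves as the doubling constant and \<open>B / A\<close> as the reverse Hoelder constant.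
\<close>

lemma RHd_bounded:
  assumes J: "endpoints J a b" and p: "0 < p"
    and w: "w \<in> borel_measurable lebesgue" and bounds: "0 < A" "\<And>x. A \<le> w x" "\<And>x. w x \<le> B"
  shows "w \<in> RHd p J"
proof -
  have pos: "0 < w x" for x using bounds by (meson less_le_trans)
  have B: "0 < B" using pos[of 0] bounds(3)[of 0] by simp
  have abs: "\<bar>w x\<bar> \<le> B" for x using pos[of x] bounds(3)[of x] by simp
  have wp: "(\<lambda>x. w x powr p) \<in> borel_measurable lebesgue" using w by measurable
  have wp_le: "w x powr p \<le> B powr p" for x
    using pos[of x] bounds(3)[of x] p by (intro powr_mono2) auto
  have "weight J w"
    using set_integrable_bounded[OF J w abs] pos by (simp add: weight_def)
  moreover have "dyadic_doubling J w"
    unfolding dyadic_doubling_def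
  proof (intro exI ballI allI impI)
    fix K I assume K: "K \<in> dyadic J" and I: "I = left_half K \<or> I = right_half K"
    obtain lo hi where ends: "endpoints K lo hi" using dyadic_endpoints[OF J K] .
    have "\<exists>lo' hi'. endpoints I lo' hi' \<and> hi' - lo' = (hi - lo) / 2"
      using endpoints_halves[OF ends] I by (force simp: field_simps)
    then obtain lo' hi' where ends': "endpoints I lo' hi'" and half: "hi' - lo' = (hi - lo) / 2"
      by blast
    have "(LINT x:K|lebesgue. w x) \<le> B * (hi - lo)"
      using set_integral_bounds(2)[OF ends w bounds(2,3)] .
    also have "\<dots> = 2 * B / A * (A * (hi' - lo'))"
      using half \<open>0 < A\<close> by simp
    also have "\<dots> \<le> 2 * B / A * (LINT x:I|lebesgue. w x)"
      using set_integral_bounds(1)[OF ends' w bounds(2,3)] \<open>0 < A\<close> B by (intro mult_left_mono) auto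
    finally show "(LINT x:K|lebesgue. w x) \<le> 2 * B / A * (LINT x:I|lebesgue. w x)" .
  qed
  moreover have "set_integrable lebesgue I (\<lambda>x. w x powr p) \<and>
        mean I (\<lambda>x. w x powr p) powr (1 / p) \<le> B / A * mean I w" if I: "I \<in> dyadic J" for I
  proof
    obtain lo hi where ends: "endpoints I lo hi" using dyadic_endpoints[OF J I] .
    then have lt: "0 < hi - lo" by (simp add: endpoints_def)
    show "set_integrable lebesgue I (\<lambda>x. w x powr p)"
      by (rule set_integrable_bounded[OF ends wp, where B="B powr p"]) (simp add: wp_le)
    note 1 = set_integral_bounds[OF ends wp, of 0 "B powr p"]
    have "0 \<le> mean I (\<lambda>x. w x powr p)" "mean I (\<lambda>x. w x powr p) \<le> B powr p"
      using 1 wp_le lt by (simp_all add: mean_def endpoints_measure(3)[OF ends] divide_simps)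
    then have "mean I (\<lambda>x. w x powr p) powr (1 / p) \<le> (B powr p) powr (1 / p)"
      using p by (intro powr_mono2) auto
    also have "\<dots> = B / A * A"
      using p B \<open>0 < A\<close> by (simp add: powr_powr)
    also have "A \<le> mean I w"
      using set_integral_bounds(1)[OF ends w bounds(2,3)] lt
      by (simp add: mean_def endpoints_measure(3)[OF ends] divide_simps mult.commute)
    then have "B / A * A \<le> B / A * mean I w"
      using B \<open>0 < A\<close> by (intro mult_left_mono) auto
    finally show "mean I (\<lambda>x. w x powr p) powr (1 / p) \<le> B / A * mean I w" .
  qed
  ultimately show ?thesis
    unfolding RHd_def by blast
qed

section \<open>Shells around the left endpoint\<close>

definition nest :: "real set \<Rightarrow> nat \<Rightarrow> real set" where
  "nest J n = (left_half ^^ n) J"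

definition shell :: "real set \<Rightarrow> nat \<Rightarrow> real set" where
  "shell J n = right_half (nest J n)"

definition shell_index :: "real set \<Rightarrow> real \<Rightarrow> nat" where
  "shell_index J x = (LEAST n. x \<in> shell J n)"

lemma nest_0: "nest J 0 = J"
  and nest_Suc: "nest J (Suc n) = left_half (nest J n)"
  by (simp_all add: nest_def)

lemma nest_endpoints:
  assumes "endpoints J a b"
  shows "endpoints (nest J n) a (a + (b - a) / 2 ^ n)"
proof (induction n)
  case (Suc n)
  have mid: "(a + (a + (b - a) / 2 ^ n)) / 2 = a + (b - a) / 2 ^ Suc n"
    by (simp add: field_simps)
  show ?case
    using endpoints_halves(1)[OF Suc] unfolding mid nest_Suc .
qed (use assms in \<open>simp add: nest_0\<close>)

lemma shell_endpoints:
  assumes "endpoints J a b"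
  shows "endpoints (shell J n) (a + (b - a) / 2 ^ Suc n) (a + (b - a) / 2 ^ n)"
proof -
  have mid: "(a + (a + (b - a) / 2 ^ n)) / 2 = a + (b - a) / 2 ^ Suc n"
    by (simp add: field_simps)
  show ?thesis
    using endpoints_halves(2)[OF nest_endpoints[OF assms], of n] unfolding mid shell_def .
qed

lemma shell_length: "(a + (b - a) / 2 ^ n) - (a + (b - a) / 2 ^ Suc n) = (b - a) / (2::real) ^ Suc n"
  by (simp add: field_simps)

lemma shell_integral_constant:
  fixes c :: real
  assumes J: "endpoints J a b" and f: "\<And>x. x \<in> shell J n \<Longrightarrow> f x = c"
  shows "(LINT x:shell J n|lebesgue. f x) = c * ((b - a) / 2 ^ Suc n)"
  using set_integral_constant[OF shell_endpoints[OF J], of n f, OF f] unfolding shell_length .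

lemma nest_split: "nest J n = nest J (Suc n) \<union> shell J n" "nest J (Suc n) \<inter> shell J n = {}"
  by (auto simp: nest_Suc shell_def left_half_def right_half_def)

lemma nest_antimono: "m \<le> n \<Longrightarrow> nest J n \<subseteq> nest J m"
  by (rule lift_Suc_antimono_le[of "nest J"]) (use nest_split(1) in blast)

lemma shell_disjoint: "m < n \<Longrightarrow> nest J n \<inter> shell J m = {}"
  using nest_antimono[of "Suc m" n J] nest_split(2)[of J m] by auto

lemma shell_subset: "shell J n \<subseteq> nest J n" "shell J n \<subseteq> J"
  using nest_split(1)[of J n] nest_antimono[of 0 n J] by (auto simp: nest_0)

lemma shell_unique: "x \<in> shell J m \<Longrightarrow> x \<in> shell J n \<Longrightarrow> m = n"
  using shell_disjoint[of m n J] shell_disjoint[of n m J] shell_subset(1)[of J m]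
    shell_subset(1)[of J n]
  by (metis disjoint_iff linorder_neqE_nat subsetD)

lemma shell_index_eq: "x \<in> shell J n \<Longrightarrow> shell_index J x = n"
  unfolding shell_index_def by (rule Least_equality) (use shell_unique in auto)

text \<open>
  The intervals \<open>nest J n\<close> shrink to the left endpoint, so any other point of \<open>J\<close> leaves them
  at a first step, and it leaves through the right half.
\<close>

lemma shells_cover:
  assumes J: "endpoints J a b" and x: "x \<in> J" "x \<noteq> a"
  obtains n where "x \<in> shell J n"
proof -
  have ends: "a < b" "a < x"
    using J x by (force simp: endpoints_def)+
  obtain n where "(b - a) / (x - a) < 2 ^ n"
    using real_arch_pow[of 2] by auto
  then have "a + (b - a) / 2 ^ n < x"
    using ends by (simp add: field_simps)
  then have "x \<notin> nest J n"
    using nest_endpoints[OF J, of n] by (auto simp: endpoints_def)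
  then have "\<exists>k<n. x \<in> nest J k \<and> x \<notin> nest J (Suc k)"
    using x(1) by (induction n) (auto simp: nest_0 less_Suc_eq)
  then show ?thesis
    using that nest_split(1) by blast
qed

section \<open>Weights that are constant on shells\<close>

text \<open>
  The mean of \<open>shell_weight J e\<close> over \<open>nest J n\<close> (shown in \<open>shell_weight_integral\<close> below when
  the weight and these means are bounded), written as the product of the ratios of consecutive means.
\<close>

definition nest_mean :: "(nat \<Rightarrow> real) \<Rightarrow> nat \<Rightarrow> real" where
  "nest_mean e n = (\<Prod>k<n. 1 + e k)"

definition shell_value :: "(nat \<Rightarrow> real) \<Rightarrow> nat \<Rightarrow> real" where
  "shell_value e n = (1 - e n) * nest_mean e n"

text \<open>
  Each point lies in at most one shell. On points in no shell (outside \<open>J\<close>, or at its left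
  endpoint) the index is an unspecified number, so that the bounds for the values on shells
  hold on the whole line.
\<close>

definition shell_weight :: "real set \<Rightarrow> (nat \<Rightarrow> real) \<Rightarrow> real \<Rightarrow> real" where
  "shell_weight J e x = shell_value e (shell_index J x)"

lemma nest_mean_0: "nest_mean e 0 = 1"
  and nest_mean_Suc: "nest_mean e (Suc n) = nest_mean e n * (1 + e n)"
  by (simp_all add: nest_mean_def)

lemma shell_weight_eq: "x \<in> shell J n \<Longrightarrow> shell_weight J e x = shell_value e n"
  by (simp add: shell_weight_def shell_index_eq)

lemma shell_weight_measurable:
  assumes J: "endpoints J a b"
  shows "shell_weight J e \<in> borel_measurable lebesgue"
proof -
  have [measurable]: "shell J n \<in> sets lebesgue" for n
    using endpoints_measure(1)[OF shell_endpoints[OF J]] .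
  have "shell_index J \<in> measurable lebesgue (count_space UNIV)"
    unfolding shell_index_def by measurable
  then show ?thesis
    unfolding shell_weight_def by measurable
qed

text \<open>
  The mass of a shell is the mass of \<open>nest J n\<close> minus that of \<open>nest J (Suc n)\<close>, in units of the
  length of \<open>J\<close>.
\<close>

lemma shell_value_telescope:
  "(\<Sum>k<n. shell_value e k / 2 ^ Suc k) = 1 - nest_mean e n / 2 ^ n"
  by (induction n) (simp_all add: nest_mean_0 nest_mean_Suc shell_value_def field_simps)

lemma nest_mean_pos: "(\<And>k. \<bar>e k\<bar> < 1) \<Longrightarrow> 0 < nest_mean e n"
  unfolding nest_mean_def by (intro prod_pos) (smt (verit))

lemma shell_value_pos: "(\<And>k. \<bar>e k\<bar> < 1) \<Longrightarrow> 0 < shell_value e n"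
  unfolding shell_value_def using nest_mean_pos[of e n] by (intro mult_pos_pos) (auto simp: abs_less_iff)

lemma shell_weight_pos: "(\<And>k. \<bar>e k\<bar> < 1) \<Longrightarrow> 0 < shell_weight J e x"
  by (simp add: shell_weight_def shell_value_pos)

text \<open>
  The masses of the shells telescope, so their partial sums are bounded by the length of \<open>J\<close>
  for every \<open>e\<close> with values in \<open>(-1, 1)\<close>. No bound on the weight enters, so this covers the
  unbounded weight produced by the \<open>\<lambda>\<close>-operation.
\<close>

lemma shell_weight_integrable:
  assumes J: "endpoints J a b" and e: "\<And>k. \<bar>e k\<bar> < 1"
  shows "set_integrable lebesgue J (shell_weight J e)"
proof -
  have lt: "a < b" using J by (simp add: endpoints_def)
  have meas[measurable]: "J \<in> sets lebesgue" "\<And>n. shell J n \<in> sets lebesgue"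
    using endpoints_measure(1)[OF J] endpoints_measure(1)[OF shell_endpoints[OF J]] by auto
  have nonneg: "0 \<le> shell_value e n" for n using shell_value_pos[of e] e by (simp add: less_imp_le)
  have summ: "summable (\<lambda>n. shell_value e n / 2 ^ Suc n * (b - a))"
  proof (intro summable_mult2 summableI_nonneg_bounded)
    show "(\<Sum>k<n. shell_value e k / 2 ^ Suc k) \<le> 1" for n
      using nest_mean_pos[of e n] e unfolding shell_value_telescope by simp
  qed (simp add: nonneg)
  have eq: "ennreal (norm (indicator J x *\<^sub>R shell_weight J e x))
      = (\<Sum>n. ennreal (shell_value e n) * indicator (shell J n) x)" if "x \<noteq> a" for x
  proof (cases "x \<in> J")
    case True
    with that obtain m where m: "x \<in> shell J m" using shells_cover[OF J] by blast
    have "(\<Sum>n. ennreal (shell_value e n) * indicator (shell J n) x)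
        = (\<Sum>n\<in>{m}. ennreal (shell_value e n) * indicator (shell J n) x)"
      using m shell_unique by (intro suminf_finite) (auto simp: indicator_def)
    then show ?thesis
      using m True nonneg by (simp add: shell_weight_eq)
  next
    case False
    then have "x \<notin> shell J n" for n using shell_subset(2) by blast
    with False show ?thesis by simp
  qed
  have "(\<integral>\<^sup>+x. ennreal (norm (indicator J x *\<^sub>R shell_weight J e x)) \<partial>lebesgue)
      = (\<integral>\<^sup>+x. (\<Sum>n. ennreal (shell_value e n) * indicator (shell J n) x) \<partial>lebesgue)"
    using eq by (intro nn_integral_cong_AE AE_I[where N="{a}"]) auto
  also have "\<dots> = (\<Sum>n. \<integral>\<^sup>+x. ennreal (shell_value e n) * indicator (shell J n) x \<partial>lebesgue)"
    using meas by (intro nn_integral_suminf) measurable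
  also have "\<dots> = (\<Sum>n. ennreal (shell_value e n / 2 ^ Suc n * (b - a)))"
  proof (intro suminf_cong)
    fix n
    have "(\<integral>\<^sup>+x. ennreal (shell_value e n) * indicator (shell J n) x \<partial>lebesgue)
        = ennreal (shell_value e n) * ennreal ((b - a) / 2 ^ Suc n)"
      using nn_integral_cmult_indicator[OF meas(2)] endpoints_measure(2)[OF shell_endpoints[OF J], of n]
      unfolding shell_length by metis
    then show "(\<integral>\<^sup>+x. ennreal (shell_value e n) * indicator (shell J n) x \<partial>lebesgue)
        = ennreal (shell_value e n / 2 ^ Suc n * (b - a))"
      using nonneg lt by (simp flip: ennreal_mult)
  qed
  also have "\<dots> = ennreal (\<Sum>n. shell_value e n / 2 ^ Suc n * (b - a))"
    using summ nonneg lt by (intro suminf_ennreal2) auto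
  finally show ?thesis
    unfolding set_integrable_def
    using shell_weight_measurable[OF J, of e] meas(1)
    by (intro integrableI_bounded) auto
qed

lemma shell_weight_integrable_dyadic:
  assumes J: "endpoints J a b" and e: "\<And>k. \<bar>e k\<bar> < 1" and K: "K \<in> dyadic J"
  shows "set_integrable lebesgue K (shell_weight J e)"
proof -
  obtain lo hi where "endpoints K lo hi" using dyadic_endpoints[OF J K] .
  then show ?thesis
    by (intro set_integrable_subset[OF shell_weight_integrable[where e=e, OF J e] endpoints_measure(1) dyadic_subset[OF K]])
qed

text \<open>
  The defect between the integral over \<open>nest J n\<close> and its predicted value is the same for all
  \<open>n\<close>, because removing one shell changes both by the same amount. For bounded data it is also
  at most a multiple of the length of \<open>nest J n\<close>, and so it is zero.
\<close>

lemma shell_weight_integral: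
  assumes J: "endpoints J a b" and bound: "\<And>n. \<bar>nest_mean e n\<bar> \<le> B" "\<And>n. \<bar>shell_value e n\<bar> \<le> B"
  shows "(LINT x:nest J n|lebesgue. shell_weight J e x) = nest_mean e n * ((b - a) / 2 ^ n)"
proof -
  define D where "D n = (LINT x:nest J n|lebesgue. shell_weight J e x) - nest_mean e n * ((b - a) / 2 ^ n)"
    for n
  have lt: "a < b" using J by (simp add: endpoints_def)
  have B: "\<bar>shell_weight J e x\<bar> \<le> B" for x by (simp add: shell_weight_def bound)
  note w = shell_weight_measurable[OF J, of e]
  have int: "set_integrable lebesgue I (shell_weight J e)" if "endpoints I lo hi" for I lo hi
    using set_integrable_bounded[OF that w B] .
  have step: "D (Suc n) = D n" for n
  proof -
    have "(LINT x:nest J n|lebesgue. shell_weight J e x)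
        = (LINT x:nest J (Suc n)|lebesgue. shell_weight J e x) + (LINT x:shell J n|lebesgue. shell_weight J e x)"
      unfolding nest_split(1)[of J n]
      by (rule set_integral_Un[OF nest_split(2) int[OF nest_endpoints[OF J]] int[OF shell_endpoints[OF J]]])
    also have "(LINT x:shell J n|lebesgue. shell_weight J e x) = shell_value e n * ((b - a) / 2 ^ Suc n)"
      using shell_weight_eq by (rule shell_integral_constant[OF J])
    finally have split: "(LINT x:nest J n|lebesgue. shell_weight J e x)
        = (LINT x:nest J (Suc n)|lebesgue. shell_weight J e x) + shell_value e n * ((b - a) / 2 ^ Suc n)" .
    define h where "h = (b - a) / 2 ^ Suc n"
    then have h: "(b - a) / 2 ^ Suc n = h" "(b - a) / 2 ^ n = 2 * h"
      by (simp_all add: field_simps)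
    show ?thesis
      unfolding D_def split h nest_mean_Suc shell_value_def by (simp add: algebra_simps)
  qed
  have D_const: "D (n + k) = D n" for k
    by (induction k) (simp_all add: step)
  have D_bound: "\<bar>D n\<bar> \<le> 2 * B * (b - a) / 2 ^ n" for n
  proof -
    have triangle: "\<bar>X - Y\<bar> \<le> H + H" if "\<bar>X\<bar> \<le> H" "\<bar>Y\<bar> \<le> H" for X Y H :: real
      using that by linarith
    have "\<bar>D n\<bar> \<le> B * ((b - a) / 2 ^ n) + B * ((b - a) / 2 ^ n)"
      unfolding D_def
    proof (rule triangle)
      show "\<bar>LINT x:nest J n|lebesgue. shell_weight J e x\<bar> \<le> B * ((b - a) / 2 ^ n)"
        using set_integral_bounds[OF nest_endpoints[OF J] w, where A="-B" and B=B, of n] B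
        by (simp add: abs_le_iff minus_le_iff)
      show "\<bar>nest_mean e n * ((b - a) / 2 ^ n)\<bar> \<le> B * ((b - a) / 2 ^ n)"
        using mult_right_mono[OF bound(1)[of n], of "(b - a) / 2 ^ n"] lt by (simp add: abs_mult)
    qed
    then show ?thesis by simp
  qed
  have lim: "(\<lambda>k. 2 * B * (b - a) / 2 ^ n * (1 / 2) ^ k) \<longlonglongrightarrow> 2 * B * (b - a) / 2 ^ n * 0"
    by (intro tendsto_mult tendsto_const LIMSEQ_power_zero) simp
  have "\<bar>D n\<bar> \<le> 2 * B * (b - a) / 2 ^ n * (1 / 2) ^ k" for k
    using D_bound[of "n + k"] by (simp add: D_const power_add power_divide)
  then have "\<bar>D n\<bar> \<le> 2 * B * (b - a) / 2 ^ n * 0"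
    by (intro LIMSEQ_le_const[OF lim]) blast
  then show ?thesis by (simp add: D_def)
qed

section \<open>Haar ratios and the \<open>\<lambda>\<close>-operation\<close>

lemma dyadic_nest_or_shell:
  assumes "I \<in> dyadic J"
  shows "(\<exists>n. I = nest J n) \<or> (\<exists>n. I \<subseteq> shell J n)"
  using assms
proof induction
  case self
  then show ?case by (metis nest_0)
next
  case (left I)
  then show ?case
    by (metis (no_types, lifting) nest_Suc left_half_def mem_Collect_eq subset_iff)
next
  case (right I)
  then show ?case
    by (metis (no_types, lifting) shell_def right_half_def mem_Collect_eq subset_iff)
qed

lemma nest_dyadic: "nest J n \<in> dyadic J"
  by (induction n) (auto simp: nest_0 nest_Suc intro: dyadic.intros)

lemma pairing_haar:
  assumes I: "I \<in> dyadic J"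
    and int: "\<And>K. K \<in> dyadic J \<Longrightarrow> set_integrable lebesgue K w"
  shows "pairing J w (haar I) = len I powr (-1/2) *
    ((LINT x:right_half I|lebesgue. w x) - (LINT x:left_half I|lebesgue. w x))"
proof -
  have sub: "left_half I \<subseteq> J" "right_half I \<subseteq> J"
    using dyadic_subset[OF I] by (auto simp: left_half_def right_half_def)
  have "pairing J w (haar I) = (LINT x|lebesgue. len I powr (-1/2) *
      (indicator (right_half I) x * w x - indicator (left_half I) x * w x))"
    unfolding pairing_def set_lebesgue_integral_def haar_def
    using sub by (intro Bochner_Integration.integral_cong) (auto simp: indicator_def algebra_simps)
  also have "\<dots> = len I powr (-1/2) *
      ((LINT x:right_half I|lebesgue. w x) - (LINT x:left_half I|lebesgue. w x))"
    using int[OF dyadic.left[OF I]] int[OF dyadic.right[OF I]]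
    by (simp add: set_integrable_def set_lebesgue_integral_def)
  finally show ?thesis .
qed

text \<open>
  The normalising power of the length occurs once in the Haar ratio and once in the Haar function,
  and the two cancel against the length from the integration. The sign changes because the Haar
  function is positive on the right half, whereas \<open>e\<close> records the gain on the left half.
\<close>

lemma haar_ratio_nest:
  assumes J: "endpoints J a b" and e: "\<And>k. \<bar>e k\<bar> < 1"
    and bound: "\<And>n. \<bar>nest_mean e n\<bar> \<le> B" "\<And>n. \<bar>shell_value e n\<bar> \<le> B"
  shows "haar_ratio J (shell_weight J e) (nest J n) * haar (nest J n) x
    = e n * (indicator (nest J (Suc n)) x - indicator (shell J n) x)"
proof -
  let ?w = "shell_weight J e" and ?L = "(b - a) / 2 ^ n"
  have L: "0 < ?L" using J by (simp add: endpoints_def)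
  have pos: "0 < nest_mean e n" using nest_mean_pos e by blast
  note int = shell_weight_integrable_dyadic[where e=e, OF J e]
  have len: "len (nest J n) = ?L"
    using endpoints_measure(3)[OF nest_endpoints[OF J]] by simp
  have mean: "mean (nest J n) ?w = nest_mean e n"
    unfolding mean_def len shell_weight_integral[OF J bound] using L
    by (metis less_irrefl mult.commute nonzero_mult_div_cancel_right times_divide_eq_right mult.right_neutral)
  have left: "(LINT x:left_half (nest J n)|lebesgue. ?w x) = nest_mean e n * (1 + e n) * (?L / 2)"
    using shell_weight_integral[OF J bound, of "Suc n"] by (simp add: nest_Suc nest_mean_Suc)
  have right: "(LINT x:right_half (nest J n)|lebesgue. ?w x) = nest_mean e n * (1 - e n) * (?L / 2)"
    using shell_integral_constant[OF J, of n ?w "shell_value e n", OF shell_weight_eq]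
    by (simp add: shell_def shell_value_def mult.commute)
  define q where "q = ?L powr (-1/2)"
  have q: "q * q * ?L = 1"
  proof -
    have "h powr (-1/2) * h powr (-1/2) * h = 1" if "0 < h" for h :: real
      using that by (simp only: powr_add[symmetric]) (simp add: powr_minus)
    then show ?thesis unfolding q_def using L .
  qed
  have "pairing J ?w (haar (nest J n)) = q *
      ((LINT x:right_half (nest J n)|lebesgue. ?w x) - (LINT x:left_half (nest J n)|lebesgue. ?w x))"
    unfolding q_def len[symmetric] using int by (rule pairing_haar[OF nest_dyadic])
  also have "\<dots> = - (q * e n * ?L) * nest_mean e n"
  proof -
    have "q * (P * (1 - c) * (h / 2) - P * (1 + c) * (h / 2)) = - (q * c * h) * P" for P c h :: real
      by (simp add: field_simps)
    then show ?thesis unfolding left right .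
  qed
  finally have "haar_ratio J ?w (nest J n) = - (q * e n * ?L)"
    unfolding haar_ratio_def mean using pos by simp
  then have "haar_ratio J ?w (nest J n) * haar (nest J n) x
      = - (q * e n * ?L) * (q * (indicator (shell J n) x - indicator (nest J (Suc n)) x))"
    by (simp add: haar_def len shell_def nest_Suc q_def)
  also have "\<dots> = (q * q * ?L) * (e n * (indicator (nest J (Suc n)) x - indicator (shell J n) x))"
  proof -
    have "- (q * c * h) * (q * (r - l)) = (q * q * h) * (c * (l - r))" for c h l r :: real
      by (simp add: algebra_simps)
    then show ?thesis .
  qed
  finally show ?thesis unfolding q by simp
qed

lemma haar_ratio_shell:
  assumes J: "endpoints J a b" and e: "\<And>k. \<bar>e k\<bar> < 1"
    and I: "I \<in> dyadic J" "I \<subseteq> shell J n"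
  shows "haar_ratio J (shell_weight J e) I = 0"
proof -
  obtain lo hi where ends: "endpoints I lo hi" using dyadic_endpoints[OF J I(1)] .
  have "x \<in> I \<Longrightarrow> shell_weight J e x = shell_value e n" for x
    using I(2) shell_weight_eq by blast
  then have "(LINT x:left_half I|lebesgue. shell_weight J e x) = shell_value e n * ((hi - lo) / 2)"
    "(LINT x:right_half I|lebesgue. shell_weight J e x) = shell_value e n * ((hi - lo) / 2)"
    using set_integral_constant[OF endpoints_halves(1)[OF ends], of "shell_weight J e" "shell_value e n"]
      set_integral_constant[OF endpoints_halves(2)[OF ends], of "shell_weight J e" "shell_value e n"]
    by (auto simp: left_half_def right_half_def field_simps)
  then show ?thesis
    by (simp add: haar_ratio_def pairing_haar[OF I(1) shell_weight_integrable_dyadic[where e=e, OF J e]])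
qed

lemma lambda_partial_shell_weight:
  assumes J: "endpoints J a b" and e: "\<And>k. \<bar>e k\<bar> < 1"
    and bound: "\<And>n. \<bar>nest_mean e n\<bar> \<le> B" "\<And>n. \<bar>shell_value e n\<bar> \<le> B"
  shows "lambda_partial J l (shell_weight J e) n x
    = (\<Prod>k<n. 1 + l * e k * (indicator (nest J (Suc k)) x - indicator (shell J k) x))"
proof -
  let ?w = "shell_weight J e"
  let ?D = "{I \<in> dyadic J. len I > 2 powr (- real n) * len J}"
  let ?f = "\<lambda>I. 1 + l * haar_ratio J ?w I * haar I x"
  have lt: "a < b" using J by (simp add: endpoints_def)
  have len: "len (nest J k) = (b - a) / 2 ^ k" for k
    using endpoints_measure(3)[OF nest_endpoints[OF J]] by simp
  have inj: "inj_on (nest J) {..<n}"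
  proof (rule inj_onI)
    fix i j assume "nest J i = nest J j"
    then have "(b - a) / 2 ^ i = (b - a) / 2 ^ j" using len by metis
    then show "i = j" using lt by simp
  qed
  have long_iff: "len (nest J k) > 2 powr (- real n) * len J \<longleftrightarrow> k < n" for k
    using lt generation_less_iff[of "b - a" n k] by (simp add: len endpoints_measure(3)[OF J])
  have "prod ?f ?D = prod ?f (nest J ` {..<n})"
  proof (rule prod.mono_neutral_right[OF finite_long_dyadic[OF J]])
    show "nest J ` {..<n} \<subseteq> ?D" using nest_dyadic long_iff by auto
    show "\<forall>I\<in>?D - nest J ` {..<n}. ?f I = 1"
    proof
      fix I assume I: "I \<in> ?D - nest J ` {..<n}"
      then have "I \<noteq> nest J k" for k using long_iff by blast
      with I obtain m where "I \<subseteq> shell J m" using dyadic_nest_or_shell by blast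
      with I show "?f I = 1" using haar_ratio_shell[where e=e, OF J e] by simp
    qed
  qed
  also have "\<dots> = (\<Prod>k<n. ?f (nest J k))"
    using prod.reindex[OF inj] by simp
  also have "\<dots> = (\<Prod>k<n. 1 + l * e k * (indicator (nest J (Suc k)) x - indicator (shell J k) x))"
    using haar_ratio_nest[OF J e bound] by (simp add: mult.assoc)
  finally show ?thesis
    by (simp add: lambda_partial_def)
qed

text \<open>
  A point of the \<open>m\<close>-th shell lies in the left half of \<open>nest J k\<close> for \<open>k < m\<close>, in the right half
  for \<open>k = m\<close>, and outside \<open>nest J k\<close> for \<open>k > m\<close>. The partial products are thus constant from
  \<open>n = m + 1\<close> on.
\<close>

lemma lambda_partial_tendsto:
  assumes J: "endpoints J a b" and e: "\<And>k. \<bar>e k\<bar> < 1"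
    and bound: "\<And>n. \<bar>nest_mean e n\<bar> \<le> B" "\<And>n. \<bar>shell_value e n\<bar> \<le> B"
    and x: "x \<in> J" "x \<noteq> a"
  shows "(\<lambda>n. lambda_partial J l (shell_weight J e) n x) \<longlonglongrightarrow> shell_weight J (\<lambda>k. l * e k) x"
proof -
  obtain m where m: "x \<in> shell J m" using shells_cover[OF J x] .
  let ?g = "\<lambda>k. 1 + l * e k * (indicator (nest J (Suc k)) x - indicator (shell J k) x)"
  have before: "?g k = 1 + l * e k" if "k < m" for k
  proof -
    have "x \<in> nest J (Suc k)" using m shell_subset(1) nest_antimono[of "Suc k" m J] that by auto
    then show ?thesis using nest_split(2)[of J k] by (auto simp: indicator_def)
  qed
  have at: "?g m = 1 - l * e m"
    using m nest_split(2)[of J m] by (auto simp: indicator_def)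
  have after: "?g k = 1" if "m < k" for k
    using m that shell_disjoint[of m k J] nest_split(1)[of J k] by (auto simp: indicator_def)
  have eq: "lambda_partial J l (shell_weight J e) n x = shell_value (\<lambda>k. l * e k) m" if "m < n" for n
  proof -
    have "(\<Prod>k<n. ?g k) = (\<Prod>k<Suc m. ?g k)"
      using that after by (intro prod.mono_neutral_right) auto
    also have "\<dots> = (\<Prod>k<m. ?g k) * ?g m"
      by simp
    also have "\<dots> = (\<Prod>k<m. 1 + l * e k) * (1 - l * e m)"
      unfolding at by (intro arg_cong2[where f="(*)"] prod.cong before refl) simp
    finally show ?thesis
      by (simp add: lambda_partial_shell_weight[OF J e bound] shell_value_def nest_mean_def)
  qed
  show ?thesis
    unfolding shell_weight_eq[OF m]
    by (rule tendsto_eventually) (use eq in \<open>auto intro: eventually_mono[OF eventually_gt_at_top[of m]]\<close>)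
qed

text \<open>
  Membership in \<open>RHd p J\<close> includes integrability of the \<open>p\<close>-th power over \<open>J\<close>, which bounds its
  integrals over single shells, and these are comparable to \<open>shell_value e n powr p / 2 ^ n\<close>.
\<close>

lemma shell_weight_not_RHd:
  assumes J: "endpoints J a b" and f: "\<And>x. x \<in> J \<Longrightarrow> x \<noteq> a \<Longrightarrow> f x = shell_weight J e x"
    and unbounded: "\<And>C. \<exists>n. C < shell_value e n powr p / 2 ^ n"
  shows "f \<notin> RHd p J"
proof
  assume "f \<in> RHd p J"
  then have int: "set_integrable lebesgue J (\<lambda>x. f x powr p)"
    by (auto simp: RHd_def intro: dyadic.self)
  have lt: "a < b" using J by (simp add: endpoints_def)
  obtain n where n: "2 * (LINT x:J|lebesgue. f x powr p) / (b - a) < shell_value e n powr p / 2 ^ n"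
    using unbounded by blast
  have meas: "shell J n \<in> sets lebesgue"
    using endpoints_measure(1)[OF shell_endpoints[OF J]] .
  have "f x powr p = shell_value e n powr p" if x: "x \<in> shell J n" for x
  proof -
    have "x \<in> J" using x shell_subset(2) by blast
    moreover have "a < x"
    proof -
      have "a + (b - a) / 2 ^ Suc n \<le> x" using x shell_endpoints[OF J, of n] by (auto simp: endpoints_def)
      moreover have "0 < (b - a) / 2 ^ Suc n" using lt by simp
      ultimately show ?thesis by linarith
    qed
    ultimately show ?thesis using f x shell_weight_eq by simp
  qed
  from shell_integral_constant[OF J this]
  have "shell_value e n powr p * ((b - a) / 2 ^ Suc n) = (LINT x:shell J n|lebesgue. f x powr p)"
    by simp
  also have "\<dots> \<le> (LINT x:J|lebesgue. f x powr p)"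
    using set_integrable_subset[OF int meas shell_subset(2)] int shell_subset(2)[of J n]
    unfolding set_integrable_def set_lebesgue_integral_def
    by (intro integral_mono) (auto simp: indicator_def)
  finally show False
    using n lt by (simp add: field_simps)
qed

section \<open>Periodic sequences and the choice of parameters\<close>

lemma nest_mean_periodic:
  "nest_mean (\<lambda>k. if Suc (k mod Suc K) = Suc K then u else v) n
    = ((1 + v) ^ K * (1 + u)) ^ (n div Suc K) * (1 + v) ^ (n mod Suc K)"
  by (induction n) (auto simp: nest_mean_0 nest_mean_Suc mod_Suc div_Suc)

text \<open>
  The same \<open>s\<close> is used for the first \<open>K\<close> entries of a period and for \<open>\<lambda>\<close>. One period consists of
  \<open>K + 1\<close> halvings; asking for \<open>2 ^ (K + 2)\<close> makes the integral of the \<open>p\<close>-th power over the shell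
  that starts a period at least double from one period to the next.
\<close>

lemma parameters_exist:
  fixes p :: real
  assumes "1 < p"
  obtains s K where "0 < s" "s < 1" "2 ^ (K + 2) \<le> ((1 + s * s) ^ K * (1 - s)) powr p"
proof -
  define t where "t = (2::real) powr (1 / p)"
  have t: "1 < t" "t < 2"
    using assms powr_less_mono[of "1 / p" 1 2] powr_less_mono[of 0 "1 / p" 2]
    by (auto simp: t_def)
  \<comment> \<open>Any \<open>s < 1\<close> with \<open>1 + s\<^sup>2 > t\<close> would do; \<open>s\<^sup>2 = t / 2\<close> works because \<open>t < 2\<close>.\<close>
  define s where "s = sqrt (t / 2)"
  have s: "0 < s" "s < 1" "s * s = t / 2"
    using t by (auto simp: s_def)
  have gt: "1 < (1 + t / 2) / t"
    using t by (simp add: field_simps)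
  obtain K where K: "t ^ 2 / (1 - s) < ((1 + t / 2) / t) ^ K"
    using real_arch_pow[OF gt] by blast
  have "t ^ (K + 2) \<le> (1 + s * s) ^ K * (1 - s)"
  proof -
    have "t ^ (K + 2) = t ^ 2 / (1 - s) * (t ^ K * (1 - s))"
      using s by (simp add: power_add power2_eq_square)
    also have "\<dots> \<le> (1 + s * s) ^ K / t ^ K * (t ^ K * (1 - s))"
      using K s t by (intro mult_right_mono) (auto simp: power_divide)
    finally show ?thesis using t by simp
  qed
  then have "(t ^ (K + 2)) powr p \<le> ((1 + s * s) ^ K * (1 - s)) powr p"
    using t assms by (intro powr_mono2) auto
  moreover have "(t ^ (K + 2)) powr p = 2 ^ (K + 2)"
  proof -
    have "(t ^ (K + 2)) powr p = (t powr p) ^ (K + 2)"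
    proof -
      have "0 < t" using t by simp
      then show ?thesis
        unfolding powr_realpow[OF \<open>0 < t\<close>, symmetric] powr_powr by (subst powr_power) auto
    qed
    also have "t powr p = 2"
      using assms by (simp add: t_def powr_powr)
    finally show ?thesis by simp
  qed
  ultimately show ?thesis
    using that s by metis
qed

section \<open>A reverse Hoelder weight whose \<open>\<lambda>\<close>-modification is not reverse Hoelder\<close>

theorem theorem1p1:
  fixes J :: "real set" and p :: real
  assumes "is_interval J" and "bounded J" and "interior J \<noteq> {}"
    and "1 < p"
  shows "\<exists>w l. weight J w \<and> mean J w = 1 \<and> w \<in> RHd p J \<and> 0 < l \<and> l < 1 \<and>
           (AE x in lebesgue. x \<in> J \<longrightarrow> convergent (\<lambda>n. lambda_partial J l w n x)) \<and>
           weight J (lambda_op J l w) \<and> lambda_op J l w \<notin> RHd p J"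
proof -
  obtain a b where J: "endpoints J a b"
    using endpoints_exist assms(1-3) by blast
  then have lt: "a < b" by (simp add: endpoints_def)
  obtain s K where s: "0 < s" "s < 1" and K: "2 ^ (K + 2) \<le> ((1 + s * s) ^ K * (1 - s)) powr p"
    using parameters_exist[OF assms(4)] .
  \<comment> \<open>This \<open>d\<close> makes the product of the factors \<open>1 + e k\<close> over one period equal to 1.\<close>
  define d where "d = 1 - 1 / (1 + s) ^ K"
  define e where "e k = (if Suc (k mod Suc K) = Suc K then - d else s)" for k
  let ?w = "shell_weight J e" and ?B = "2 * (1 + s) ^ K"
  have pow: "1 \<le> (1 + s) ^ K" using s by simp
  then have d: "0 \<le> d" "d < 1" by (simp_all add: d_def)
  have e_range: "\<bar>e k\<bar> < 1" "e k \<le> s" for k using s d by (auto simp: e_def)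
  have "(1 + s) ^ K * (1 + - d) = 1" using s by (simp add: d_def)
  then have nest_mean_e: "nest_mean e n = (1 + s) ^ (n mod Suc K)" for n
    using nest_mean_periodic[of K "-d" s n] by (simp add: e_def[abs_def])
  have nest_mean_range: "1 \<le> nest_mean e n" "nest_mean e n \<le> (1 + s) ^ K" for n
    using s power_increasing[of "n mod Suc K" K "1 + s"] by (auto simp: nest_mean_e less_Suc_eq_le[symmetric])
  have value_range: "1 - s \<le> shell_value e n" "shell_value e n \<le> ?B" for n
  proof -
    have "1 - s \<le> 1 - e n" "1 - e n \<le> 2" using e_range[of n] by auto
    then show "1 - s \<le> shell_value e n" "shell_value e n \<le> ?B"
      using mult_mono[of "1 - s" "1 - e n" 1 "nest_mean e n"]
        mult_mono[of "1 - e n" 2 "nest_mean e n" "(1 + s) ^ K"] nest_mean_range[of n] s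
      by (auto simp: shell_value_def)
  qed
  have bound: "\<bar>nest_mean e n\<bar> \<le> ?B" "\<bar>shell_value e n\<bar> \<le> ?B" for n
    using nest_mean_range[of n] value_range[of n] s by auto
  have RH: "?w \<in> RHd p J"
    using assms(4) s value_range
    by (intro RHd_bounded[OF J _ shell_weight_measurable[OF J], where A="1 - s" and B="?B"])
       (auto simp: shell_weight_def)
  have mean: "mean J ?w = 1"
    using shell_weight_integral[OF J bound, of 0] lt
    by (simp add: nest_0 mean_def nest_mean_0 endpoints_measure(3)[OF J])

  \<comment> \<open>The new weight agrees with \<open>?v\<close> except at the left endpoint.\<close>
  let ?v = "shell_weight J (\<lambda>k. s * e k)"
  have conv: "(\<lambda>n. lambda_partial J s ?w n x) \<longlonglongrightarrow> ?v x" if "x \<in> J" "x \<noteq> a" for x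
    using lambda_partial_tendsto[OF J e_range(1) bound that] .
  then have v: "lambda_op J s ?w x = ?v x" if "x \<in> J" "x \<noteq> a" for x
    using that by (simp add: lambda_op_def limI)
  have se: "\<bar>s * e k\<bar> < 1" "s * e k \<le> s" for k
  proof -
    have "\<bar>s * e k\<bar> \<le> s"
      using s e_range(1)[of k] by (simp add: abs_mult mult_left_le)
    then show "\<bar>s * e k\<bar> < 1" "s * e k \<le> s"
      using s by linarith+
  qed
  have a_null: "AE x in lebesgue. x \<noteq> a"
    by (rule AE_I[where N="{a}"]) auto
  have AE_conv: "AE x in lebesgue. x \<in> J \<longrightarrow> convergent (\<lambda>n. lambda_partial J s ?w n x)"
    using a_null by eventually_elim (use conv convergentI in blast)
  have "set_integrable lebesgue J (lambda_op J s ?w)"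
    using shell_weight_integrable[OF J se(1)] unfolding set_integrable_def
    by (subst integrable_discrete_difference[where X="{a}" and g="\<lambda>x. indicator J x *\<^sub>R ?v x"])
       (auto simp: v indicator_def)
  moreover have "AE x in lebesgue. x \<in> J \<longrightarrow> 0 < lambda_op J s ?w x"
    using a_null by eventually_elim (simp add: v shell_weight_pos[OF se(1)])
  ultimately have weight_v: "weight J (lambda_op J s ?w)" by (simp add: weight_def)

  \<comment> \<open>\<open>?q\<close> is the growth of the means of \<open>?v\<close> over one period.\<close>
  let ?q = "(1 + s * s) ^ K * (1 - s * d)"
  have "s * d \<le> s" using s d by (simp add: mult_left_le)
  then have "1 - s \<le> 1 - s * d" "0 < 1 - s * d" using s by linarith+
  moreover have "0 < (1 + s * s) ^ K" using s by (simp add: add_pos_pos)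
  ultimately have "(1 + s * s) ^ K * (1 - s) \<le> ?q" and q: "0 < ?q"
    by (auto intro: mult_left_mono)
  then have "((1 + s * s) ^ K * (1 - s)) powr p \<le> ?q powr p"
    using s assms(4) by (intro powr_mono2) auto
  then have q_large: "2 ^ (K + 2) \<le> ?q powr p" using K by linarith
  have nest_mean_v: "nest_mean (\<lambda>k. s * e k) (j * Suc K) = ?q ^ j" for j
  proof -
    have "(\<lambda>k. s * e k) = (\<lambda>k. if Suc (k mod Suc K) = Suc K then s * - d else s * s)"
      by (auto simp: e_def)
    then show ?thesis
      using nest_mean_periodic[of K "s * - d" "s * s" "j * Suc K"] by (simp del: mult_Suc_right)
  qed
  have growth: "(1 - s) powr p * 2 ^ j \<le> shell_value (\<lambda>k. s * e k) (j * Suc K) powr p / 2 ^ (j * Suc K)" for j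
  proof -
    have "(1 - s) powr p * 2 ^ j * 2 ^ (j * Suc K) = (1 - s) powr p * (2 ^ (K + 2)) ^ j"
    proof -
      have "j + j * Suc K = (K + 2) * j" by simp
      then show ?thesis by (simp only: mult.assoc power_mult[symmetric] power_add[symmetric])
    qed
    also have "\<dots> \<le> (1 - s) powr p * (?q powr p) ^ j"
      using q_large by (intro mult_left_mono power_mono) auto
    also have "\<dots> = ((1 - s) * ?q ^ j) powr p"
    proof -
      have "c powr p * (r powr p) ^ j = (c * r ^ j) powr p" if "0 < c" "0 < r" for c r :: real
        using that by (simp add: powr_mult powr_power powr_powr mult.commute flip: powr_realpow)
      then show ?thesis using q s by simp
    qed
    also have "\<dots> \<le> shell_value (\<lambda>k. s * e k) (j * Suc K) powr p"
      unfolding shell_value_def nest_mean_v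
      using q s assms(4) se(2) by (intro powr_mono2 mult_right_mono) auto
    finally show ?thesis by (simp add: field_simps)
  qed
  have "lambda_op J s ?w \<notin> RHd p J"
  proof (rule shell_weight_not_RHd[OF J v])
    fix C :: real
    obtain j where "C / (1 - s) powr p < 2 ^ j"
      using real_arch_pow[of 2] by auto
    then have "C < (1 - s) powr p * 2 ^ j"
      using s by (simp add: field_simps)
    with growth[of j] show "\<exists>n. C < shell_value (\<lambda>k. s * e k) n powr p / 2 ^ n"
      by (meson less_le_trans)
  qed
  with RH mean s AE_conv weight_v show ?thesis
    by (intro exI[of _ ?w] exI[of _ s]) (auto simp: RHd_def)
qed

end
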